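(* Let $G$ be a non-crossing plane polygon that is not convex, or a non-crossing plane polygonal arc, whose vertex set is in general position in $\mathbb{R}^2$ (for an arc: not all vertices on a line). Then $G$ has an expansive flex that is strictly expansive on at least one pair of vertices.
   Context: General position: no three vertices collinear. A flex of $G$ is an infinitesimal motion $v$ of its vertices with $\langle p_i-p_j,v_i-v_j\rangle=0$ for every edge $ij$ of $G$; it is expansive if $\langle p_i-p_j,v_i-v_j\rangle\ge0$ for all pairs of vertices $i,j$, and strictly expansive on $ij$ if the inequality is strict. *)

theory Defs
  imports "HOL-Analysis.Analysis"
begin

text \<open>A framework: n vertices indexed 0..n-1 with positions p i in the plane.\<close>

definition polygon_edges :: "nat \<Rightarrow> (nat \<times> nat) set" where
  "polygon_edges n = {(i, (i + 1) mod n) | i. i < n}"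

definition arc_edges :: "nat \<Rightarrow> (nat \<times> nat) set" where
  "arc_edges n = {(i, i + 1) | i. i + 1 < n}"

definition non_crossing :: "nat \<Rightarrow> (nat \<Rightarrow> real^2) \<Rightarrow> (nat \<times> nat) set \<Rightarrow> bool" where
  "non_crossing n p E \<longleftrightarrow> inj_on p {..<n} \<and>
     (\<forall>(a,b)\<in>E. \<forall>(c,d)\<in>E. {a,b} \<noteq> {c,d} \<longrightarrow>
        closed_segment (p a) (p b) \<inter> closed_segment (p c) (p d) \<subseteq> p ` ({a,b} \<inter> {c,d}))"

definition general_position :: "nat \<Rightarrow> (nat \<Rightarrow> real^2) \<Rightarrow> bool" where
  "general_position n p \<longleftrightarrow>
     (\<forall>i<n. \<forall>j<n. \<forall>k<n. i \<noteq> j \<and> i \<noteq> k \<and> j \<noteq> k \<longrightarrow> \<not> collinear {p i, p j, p k})"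

definition cross2 :: "real^2 \<Rightarrow> real^2 \<Rightarrow> real" where
  "cross2 u w = u$1 * w$2 - u$2 * w$1"

definition convex_polygon :: "nat \<Rightarrow> (nat \<Rightarrow> real^2) \<Rightarrow> bool" where
  "convex_polygon n p \<longleftrightarrow>
     (\<forall>(i,j)\<in>polygon_edges n.
        (\<forall>k<n. cross2 (p j - p i) (p k - p i) \<ge> 0) \<or>
        (\<forall>k<n. cross2 (p j - p i) (p k - p i) \<le> 0))"

definition is_flex :: "nat \<Rightarrow> (nat \<Rightarrow> real^2) \<Rightarrow> (nat \<times> nat) set \<Rightarrow> (nat \<Rightarrow> real^2) \<Rightarrow> bool" where
  "is_flex n p E v \<longleftrightarrow> (\<forall>(i,j)\<in>E. inner (p i - p j) (v i - v j) = 0)"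

definition expansive :: "nat \<Rightarrow> (nat \<Rightarrow> real^2) \<Rightarrow> (nat \<Rightarrow> real^2) \<Rightarrow> bool" where
  "expansive n p v \<longleftrightarrow> (\<forall>i<n. \<forall>j<n. inner (p i - p j) (v i - v j) \<ge> 0)"

definition strictly_expansive_on :: "(nat \<Rightarrow> real^2) \<Rightarrow> (nat \<Rightarrow> real^2) \<Rightarrow> nat \<Rightarrow> nat \<Rightarrow> bool" where
  "strictly_expansive_on p v i j \<longleftrightarrow> inner (p i - p j) (v i - v j) > 0"

end

theory Submission
  imports Defs
begin

text \<open>
By Stiemke's lemma, if there is no such flex then there is an equilibrium stress \<open>\<omega>\<close> on all pairs of
vertices that is positive on every pair that is not a bar. Its Maxwell--Cremona lift has a closed
form: for any line \<open>L\<close> through \<open>x\<close>, the height at \<open>x\<close> is, up to a constant factor, the sum of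
\<open>\<omega> i j * \<bar>cross2 (p i - x) (p j - x)\<bar>\<close> over the pairs separated by \<open>L\<close>; equilibrium makes it independent
of \<open>L\<close>. Taking for \<open>L\<close> a line that avoids the hull shows that the lift has compact support, and
restricting to \<open>L\<close> itself exhibits its convex creases.

Through every point there is a line that crosses no bar at that point, because bars do not cross and at
most two meet at a vertex. Along that line the lift is midpoint convex, so it has no positive
maximum. Next to an edge of the convex hull that is not a bar the lift would be positive. Hence all hull
edges are bars, which is impossible for an arc and makes a polygon convex.
\<close>

section \<open>Theorems of the alternative for linear functionals\<close>

text \<open>Linearity in one identity: with \<open>a = 1\<close> and zero families it already gives
  the value 0 at zero, hence homogeneity.\<close>

definition fun_linear :: "(('i \<Rightarrow> 'b::real_vector) \<Rightarrow> real) \<Rightarrow> bool" where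
  "fun_linear f \<longleftrightarrow> (\<forall>a v w. f (\<lambda>i. v i + a *\<^sub>R w i) = f v + a * f w)"

lemma fun_linear_diff_scale:
  assumes "fun_linear f"
  shows "f (\<lambda>i. v i - a *\<^sub>R w i) = f v - a * f w"
  using assms[unfolded fun_linear_def, rule_format, of v "-a" w] by simp

lemma fun_linear_scale:
  assumes "fun_linear f"
  shows "f (\<lambda>i. a *\<^sub>R w i) = a * f w"
proof -
  have "f (\<lambda>i. 0) = 0"
    using assms[unfolded fun_linear_def, rule_format, of "\<lambda>i. 0" 1 "\<lambda>i. 0"] by simp
  then show ?thesis
    using assms[unfolded fun_linear_def, rule_format, of "\<lambda>i. 0" a w] by simp
qed

lemma fun_linear_uminus: "fun_linear f \<Longrightarrow> fun_linear (\<lambda>v. - f v)"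
  by (simp add: fun_linear_def)

text \<open>Bartl's proof: projecting along a vector \<open>z\<close> on which only the new constraint is violated removes
  that constraint.\<close>

lemma Farkas_fun_linear:
  fixes f :: "('i \<Rightarrow> 'b::real_vector) \<Rightarrow> real" and g :: "'k \<Rightarrow> ('i \<Rightarrow> 'b) \<Rightarrow> real"
  assumes "finite K" "\<And>k. k \<in> K \<Longrightarrow> fun_linear (g k)" "fun_linear f"
    and "\<And>v. (\<And>k. k \<in> K \<Longrightarrow> g k v \<le> 0) \<Longrightarrow> f v \<le> 0"
  shows "\<exists>l. (\<forall>k\<in>K. 0 \<le> l k) \<and> (\<forall>v. f v = (\<Sum>k\<in>K. l k * g k v))"
  using assms
proof (induction K arbitrary: f g rule: finite_induct)
  case empty
  have "f v = 0" for v
    \<comment> \<open>With no constraints the hypothesis applies to \<open>v\<close> and to its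
      negative alike.\<close>
    using empty(3)[of v] empty(3)[of "\<lambda>i. (-1) *\<^sub>R v i"] fun_linear_scale[OF empty(2), of "-1" v]
    by simp
  then show ?case by simp
next
  case (insert m K)
  have lin: "fun_linear (g k)" if "k \<in> insert m K" for k using insert.prems(1) that by blast
  show ?case
  proof (cases "\<forall>v. (\<forall>k\<in>K. g k v \<le> 0) \<longrightarrow> f v \<le> 0")
    case True
    then obtain l where l: "\<forall>k\<in>K. 0 \<le> l k" "\<forall>v. f v = (\<Sum>k\<in>K. l k * g k v)"
      using insert.IH[of g f] insert.prems by blast
    define l' where "l' = l(m := 0)"
    have "(\<Sum>k\<in>insert m K. l' k * g k v) = (\<Sum>k\<in>K. l k * g k v)" for v
      using insert.hyps by (auto simp: l'_def intro!: sum.cong)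
    moreover have "\<forall>k\<in>insert m K. 0 \<le> l' k" using l by (auto simp: l'_def)
    ultimately show ?thesis using l(2) by metis
  next
    case False
    then obtain y where y: "\<forall>k\<in>K. g k y \<le> 0" "f y > 0" by (auto simp: not_le)
    have gy: "g m y > 0"
    proof (rule ccontr)
      assume "\<not> g m y > 0"
      then have "f y \<le> 0" using y(1) by (intro insert.prems(3)) auto
      then show False using y(2) by simp
    qed
    define z where "z = (\<lambda>i. (1 / g m y) *\<^sub>R y i)"
    have gz: "g k z = g k y / g m y" if "k \<in> insert m K" for k
      unfolding z_def using fun_linear_scale[OF lin[OF that]] by simp
    have fz: "f z > 0" unfolding z_def using fun_linear_scale[OF insert.prems(2)] y gy by simp
    have gzK: "g k z \<le> 0" if "k \<in> K" for k
      using gz y(1) gy that by (simp add: divide_nonpos_pos)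
    have gz1: "g m z = 1" using gz gy by simp
    let ?P = "\<lambda>v. (\<lambda>i. v i - g m v *\<^sub>R z i)"
    have PL: "?P (\<lambda>i. v i + a *\<^sub>R w i) = (\<lambda>i. ?P v i + a *\<^sub>R ?P w i)" for v a w
    proof -
      have "g m (\<lambda>i. v i + a *\<^sub>R w i) = g m v + a * g m w"
        using lin[of m] by (simp add: fun_linear_def)
      then show ?thesis by (simp add: algebra_simps)
    qed
    have linP: "fun_linear (\<lambda>v. h (?P v))" if "fun_linear h" for h
      unfolding fun_linear_def PL using that by (simp add: fun_linear_def)
    have hP: "h (?P v) = h v - g m v * h z" if "fun_linear h" for h v
      using fun_linear_diff_scale[OF that] .
    have "\<exists>l. (\<forall>k\<in>K. 0 \<le> l k) \<and> (\<forall>v. f (?P v) = (\<Sum>k\<in>K. l k * g k (?P v)))"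
    proof (rule insert.IH)
      show "fun_linear (\<lambda>v. g k (?P v))" if "k \<in> K" for k using linP lin that by blast
      show "fun_linear (\<lambda>v. f (?P v))" using linP insert.prems by blast
      show "f (?P v) \<le> 0" if "\<And>k. k \<in> K \<Longrightarrow> g k (?P v) \<le> 0" for v
      proof (rule insert.prems(3))
        fix k assume "k \<in> insert m K"
        then show "g k (?P v) \<le> 0" using that hP[OF lin[of m], of v] gz1 by auto
      qed
    qed
    then obtain l where l: "\<forall>k\<in>K. 0 \<le> l k" "\<And>v. f (?P v) = (\<Sum>k\<in>K. l k * g k (?P v))" by blast
    \<comment> \<open>The coefficient of \<open>m\<close> is forced by comparing both sides at
      \<open>z\<close>, where \<open>g m z = 1\<close>. It is nonnegative because
      \<open>f z > 0\<close> while \<open>g k z\<close> is nonpositive for all \<open>k\<close> in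
      \<open>K\<close>.\<close>
    define l' where "l' = l(m := f z - (\<Sum>k\<in>K. l k * g k z))"
    have "(\<Sum>k\<in>K. l k * g k z) \<le> 0"
      using l(1) gzK by (intro sum_nonpos) (simp add: mult_nonneg_nonpos)
    then have "\<forall>k\<in>insert m K. 0 \<le> l' k" using l(1) fz by (auto simp: l'_def)
    moreover have "f v = (\<Sum>k\<in>insert m K. l' k * g k v)" for v
    proof -
      have 1: "(\<Sum>k\<in>K. l' k * g k v) = (\<Sum>k\<in>K. l k * g k v)"
        using insert.hyps by (auto simp: l'_def intro!: sum.cong)
      have "f v - g m v * f z = (\<Sum>k\<in>K. l k * (g k v - g m v * g k z))"
        using l(2)[of v] hP[OF insert.prems(2), of v] hP[OF lin, of _ v] by (simp cong: sum.cong)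
      also have "\<dots> = (\<Sum>k\<in>K. l k * g k v) - g m v * (\<Sum>k\<in>K. l k * g k z)"
        by (simp add: algebra_simps sum_subtractf sum_distrib_left)
      finally show ?thesis using insert.hyps 1 by (simp add: l'_def algebra_simps)
    qed
    ultimately show ?thesis by blast
  qed
qed

text \<open>By \<open>none\<close>, each \<open>f k\<close> is nonpositive wherever all the
  functionals are nonnegative, so Farkas writes it as a nonnegative combination of their negatives.
  Adding these relations over all \<open>k\<close> gives every functional a coefficient of at least
  1.\<close>

lemma Stiemke_fun_linear:
  fixes f :: "'k \<Rightarrow> ('i \<Rightarrow> 'b::real_vector) \<Rightarrow> real"
  assumes "finite K" "\<And>k. k \<in> K \<Longrightarrow> fun_linear (f k)"
    and none: "\<And>v k. (\<And>k. k \<in> K \<Longrightarrow> 0 \<le> f k v) \<Longrightarrow> k \<in> K \<Longrightarrow> f k v \<le> 0"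
  shows "\<exists>l. (\<forall>k\<in>K. 0 < l k) \<and> (\<forall>v. (\<Sum>k\<in>K. l k * f k v) = 0)"
proof -
  have "\<exists>l. (\<forall>j\<in>K. 0 \<le> l j) \<and> (\<forall>v. f k v = (\<Sum>j\<in>K. l j * - f j v))" if "k \<in> K" for k
    using assms that by (intro Farkas_fun_linear) (auto intro: fun_linear_uminus)
  then obtain l where l: "\<And>k j. k \<in> K \<Longrightarrow> j \<in> K \<Longrightarrow> 0 \<le> l k j"
    "\<And>k v. k \<in> K \<Longrightarrow> f k v = (\<Sum>j\<in>K. l k j * - f j v)" by metis
  define m where "m = (\<lambda>j. 1 + (\<Sum>k\<in>K. l k j))"
  have "(\<Sum>j\<in>K. m j * f j v) = 0" for v
  proof -
    have "(\<Sum>j\<in>K. m j * f j v) = (\<Sum>j\<in>K. f j v) + (\<Sum>j\<in>K. \<Sum>k\<in>K. l k j * f j v)"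
      by (simp add: m_def distrib_right sum.distrib sum_distrib_right)
    also have "(\<Sum>j\<in>K. \<Sum>k\<in>K. l k j * f j v) = (\<Sum>k\<in>K. \<Sum>j\<in>K. l k j * f j v)"
      by (rule sum.swap)
    also have "\<dots> = (\<Sum>k\<in>K. - f k v)"
      using l(2) by (intro sum.cong) (simp_all add: sum_negf)
    finally show ?thesis by (simp add: sum_negf)
  qed
  moreover have "\<forall>j\<in>K. 0 < m j"
    unfolding m_def using l(1) by (auto intro!: add_pos_nonneg sum_nonneg)
  ultimately show ?thesis by blast
qed

section \<open>Existence of an equilibrium stress\<close>

definition bar :: "(nat \<times> nat) set \<Rightarrow> nat \<Rightarrow> nat \<Rightarrow> bool" where
  "bar E i j \<longleftrightarrow> (i, j) \<in> E \<or> (j, i) \<in> E"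

lemma equilibrium_stress_exists:
  fixes p :: "nat \<Rightarrow> real^2"
  assumes E: "E \<subseteq> {..<n} \<times> {..<n}"
    and none: "\<not> (\<exists>v. is_flex n p E v \<and> expansive n p v \<and>
                   (\<exists>i<n. \<exists>j<n. strictly_expansive_on p v i j))"
  obtains \<omega> :: "nat \<Rightarrow> nat \<Rightarrow> real" where
    "\<And>i j. \<omega> i j = \<omega> j i"
    "\<And>i j. i < n \<Longrightarrow> j < n \<Longrightarrow> \<not> bar E i j \<Longrightarrow> 0 < \<omega> i j"
    "\<And>i. i < n \<Longrightarrow> (\<Sum>j<n. \<omega> i j *\<^sub>R (p j - p i)) = 0"
proof -
  define N where "N = {..<n} \<times> {..<n}"
  define q where "q = (\<lambda>(i,j) (v :: nat \<Rightarrow> real^2). inner (p i - p j) (v i - v j))"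
  \<comment> \<open>\<open>Inl\<close> carries the expansion inequality of each ordered pair and
    \<open>Inr\<close> the reversed inequality of each bar, so that together they describe the
    expansive flexes.\<close>
  define f where "f = (\<lambda>k. case k of Inl e \<Rightarrow> q e | Inr e \<Rightarrow> (\<lambda>v. - q e v))"
  define K where "K = Inl ` N \<union> Inr ` E"
  have finN: "finite N" and finE: "finite E"
    using E finite_subset by (auto simp: N_def)
  have q_lin: "fun_linear (q e)" for e
    by (cases e) (auto simp: fun_linear_def q_def inner_diff_right inner_add_right
        inner_diff_left algebra_simps)
  have "\<exists>l. (\<forall>k\<in>K. 0 < l k) \<and> (\<forall>v. (\<Sum>k\<in>K. l k * f k v) = 0)"
  proof (rule Stiemke_fun_linear)
    show "finite K" using finN finE by (simp add: K_def)
    show "fun_linear (f k)" for k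
      using q_lin fun_linear_uminus by (auto simp: f_def split: sum.splits)
    fix v k assume nn: "\<And>k. k \<in> K \<Longrightarrow> 0 \<le> f k v" and k: "k \<in> K"
    have N: "0 \<le> q e v" if "e \<in> N" for e using nn[of "Inl e"] that by (simp add: K_def f_def)
    have Z: "q e v = 0" if "e \<in> E" for e
      using nn[of "Inr e"] N[of e] that E by (force simp: K_def f_def N_def)
    have "expansive n p v" using N by (force simp: expansive_def q_def N_def)
    moreover have "is_flex n p E v" using Z by (force simp: is_flex_def q_def)
    ultimately have "\<not> (\<exists>i<n. \<exists>j<n. strictly_expansive_on p v i j)" using none by blast
    then have "q e v \<le> 0" if "e \<in> N" for e
      using that by (cases e) (force simp: q_def strictly_expansive_on_def N_def)
    then show "f k v \<le> 0" using k Z by (auto simp: K_def f_def)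
  qed
  then obtain l where l: "\<And>k. k \<in> K \<Longrightarrow> 0 < l k" "\<And>v. (\<Sum>k\<in>K. l k * f k v) = 0" by blast
  \<comment> \<open>On a bar this is a difference of two positive numbers, so its sign is free; on
    every other pair it stays positive.\<close>
  define m where "m = (\<lambda>i j. l (Inl (i,j)) - (if (i,j) \<in> E then l (Inr (i,j)) else 0))"
  have msum: "(\<Sum>i<n. \<Sum>j<n. m i j * inner (p i - p j) (v i - v j)) = 0" for v
  proof -
    have EN: "N \<inter> E = E" using E by (auto simp: N_def)
    have "(\<Sum>k\<in>K. l k * f k v) = (\<Sum>k\<in>Inl ` N. l k * f k v) + (\<Sum>k\<in>Inr ` E. l k * f k v)"
      unfolding K_def using finN finE by (intro sum.union_disjoint) auto
    also have "\<dots> = (\<Sum>e\<in>N. l (Inl e) * q e v) - (\<Sum>e\<in>E. l (Inr e) * q e v)"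
      by (simp add: sum.reindex inj_on_def f_def sum_negf)
    also have "(\<Sum>e\<in>E. l (Inr e) * q e v) = (\<Sum>e\<in>N. if e \<in> E then l (Inr e) * q e v else 0)"
      using finN by (simp add: sum.inter_restrict[symmetric] EN)
    also have "(\<Sum>e\<in>N. l (Inl e) * q e v) - \<dots> = (\<Sum>(i,j)\<in>N. m i j * q (i,j) v)"
      unfolding sum_subtractf[symmetric]
      by (intro sum.cong) (auto simp: m_def algebra_simps)
    also have "\<dots> = (\<Sum>i<n. \<Sum>j<n. m i j * q (i,j) v)"
      unfolding N_def by (rule sum.cartesian_product[symmetric])
    finally show ?thesis using l(2) by (simp add: q_def)
  qed
  define \<omega> where "\<omega> = (\<lambda>i j. m i j + m j i)"
  have eq: "(\<Sum>j<n. \<omega> i j *\<^sub>R (p j - p i)) = 0" if i: "i < n" for i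
  proof -
    let ?S = "\<Sum>j<n. \<omega> i j *\<^sub>R (p j - p i)"
    \<comment> \<open>The test motion displaces vertex \<open>i\<close> alone, by the resultant
      force on it; the virtual work is then minus the squared norm of that force.\<close>
    define v where "v = (\<lambda>k. if k = i then ?S else 0)"
    define T where "T = (\<lambda>a b. m a b * inner (p a - p b) ?S)"
    have row: "(\<Sum>b<n. m a b * inner (p a - p b) (v a - v b)) =
        (if a = i then \<Sum>b<n. T a b else 0) - T a i" if "a < n" for a
    proof -
      have "(\<Sum>b<n. m a b * inner (p a - p b) (v a - v b)) =
          (\<Sum>b<n. (if a = i then T a b else 0) - (if b = i then T a i else 0))"
        by (intro sum.cong) (auto simp: v_def T_def algebra_simps)
      then show ?thesis using i by (simp add: sum_subtractf)
    qed
    have "0 = (\<Sum>a<n. (if a = i then \<Sum>b<n. T a b else 0) - T a i)"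
      using msum[of v] row by simp
    also have "\<dots> = (\<Sum>b<n. T i b) - (\<Sum>a<n. T a i)"
      using i by (simp add: sum_subtractf)
    also have "\<dots> = (\<Sum>b<n. - inner (\<omega> i b *\<^sub>R (p b - p i)) ?S)"
      unfolding sum_subtractf[symmetric]
      by (intro sum.cong) (auto simp: T_def \<omega>_def inner_diff_left algebra_simps)
    also have "\<dots> = - inner ?S ?S"
      by (simp only: sum_negf inner_sum_left)
    finally show ?thesis by simp
  qed
  show thesis
  proof (rule that[of \<omega>])
    show "0 < \<omega> i j" if "i < n" "j < n" "\<not> bar E i j" for i j
    proof -
      have "Inl (i,j) \<in> K" "Inl (j,i) \<in> K" using that by (auto simp: K_def N_def)
      then show ?thesis using that l(1) by (auto simp: \<omega>_def m_def bar_def intro: add_pos_pos)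
    qed
  qed (use eq in \<open>auto simp: \<omega>_def\<close>)
qed

section \<open>The planar cross product\<close>

lemma cross2_diff_right: "cross2 u (v - w) = cross2 u v - cross2 u w"
  and cross2_add_right: "cross2 u (v + w) = cross2 u v + cross2 u w"
  and cross2_diff_left: "cross2 (v - w) u = cross2 v u - cross2 w u"
  and cross2_add_left: "cross2 (v + w) u = cross2 v u + cross2 w u"
  and cross2_scaleR_right: "cross2 u (a *\<^sub>R v) = a * cross2 u v"
  and cross2_scaleR_left: "cross2 (a *\<^sub>R v) u = a * cross2 v u"
  and cross2_minus_left: "cross2 (- v) u = - cross2 v u"
  and cross2_minus_right: "cross2 u (- v) = - cross2 u v"
  and cross2_self: "cross2 u u = 0"
  and cross2_0_left: "cross2 0 u = 0"
  and cross2_0_right: "cross2 u 0 = 0"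
  by (simp_all add: cross2_def algebra_simps)

lemmas cross2_linear = cross2_diff_right cross2_add_right cross2_diff_left cross2_add_left
  cross2_scaleR_right cross2_scaleR_left cross2_minus_left cross2_minus_right
  cross2_self cross2_0_left cross2_0_right

lemma cross2_commute: "cross2 v u = - cross2 u v"
  by (simp add: cross2_def)

lemma cross2_sum_right: "cross2 u (sum f A) = (\<Sum>i\<in>A. cross2 u (f i))"
  by (induction A rule: infinite_finite_induct) (simp_all add: cross2_linear)

lemma cross2_Plucker: "cross2 u u' * cross2 a b = cross2 u a * cross2 u' b - cross2 u b * cross2 u' a"
  by (simp add: cross2_def algebra_simps)

lemma continuous_cross2 [continuous_intros]:
  "continuous F f \<Longrightarrow> continuous F g \<Longrightarrow> continuous F (\<lambda>x. cross2 (f x) (g x))"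
  unfolding cross2_def by (intro continuous_intros)

text \<open>The counterclockwise quarter turn, which supplies a direction transverse to a given
  one.\<close>

definition perp :: "real^2 \<Rightarrow> real^2" where
  "perp u = vector [- (u$2), u$1]"

lemma cross2_perp: "cross2 u (perp u) = inner u u"
  by (simp add: cross2_def perp_def inner_vec_def UNIV_2 power2_eq_square)

lemma cross2_perp_pos: "u \<noteq> 0 \<Longrightarrow> cross2 u (perp u) > 0"
  by (simp add: cross2_perp)

lemma perp_nonzero: "u \<noteq> 0 \<Longrightarrow> perp u \<noteq> 0"
  using cross2_perp_pos[of u] by (auto simp: cross2_linear)

lemma cross2_eq_0_scaleR:
  assumes "u \<noteq> 0" "cross2 u a = 0"
  obtains t where "a = t *\<^sub>R u"
proof
  have uu: "u$1 * u$1 + u$2 * u$2 \<noteq> 0"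
    using assms(1) by (auto simp: vec_eq_iff forall_2 sum_squares_eq_zero_iff)
  show "a = (inner u a / inner u u) *\<^sub>R u"
    using assms(2) uu
    by (simp add: vec_eq_iff forall_2 cross2_def inner_vec_def UNIV_2 field_simps)
qed

text \<open>The offsets of \<open>a\<close> and \<open>b\<close> from the line through
  \<open>x\<close> along \<open>u\<close> serve as weights, which makes \<open>w\<close> parallel to
  \<open>u\<close>. A nonzero \<open>w\<close> would put \<open>b - x\<close> parallel to
  \<open>u\<close> as well, so \<open>w = 0\<close> and \<open>x\<close> is the weighted mean. The
  point \<open>a\<close> may lie on the line, in accordance with the half-open sides used
  below.\<close>

lemma cross2_zero_imp_segment:
  assumes c: "cross2 (a - x) (b - x) = 0" and a: "cross2 u (a - x) \<ge> 0" and b: "cross2 u (b - x) < 0"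
  shows "x \<in> closed_segment a b"
proof -
  define \<alpha> \<beta> where "\<alpha> = cross2 u (a - x)" and "\<beta> = - cross2 u (b - x)"
  define w where "w = \<beta> *\<^sub>R (a - x) + \<alpha> *\<^sub>R (b - x)"
  have pos: "\<alpha> + \<beta> > 0" using a b by (simp add: \<alpha>_def \<beta>_def)
  have "w = 0"
  proof (rule ccontr)
    assume w: "w \<noteq> 0"
    have "cross2 w u = 0"
      using cross2_commute[of _ u] by (simp add: w_def \<alpha>_def \<beta>_def cross2_linear algebra_simps)
    then obtain s where s: "u = s *\<^sub>R w" using w cross2_eq_0_scaleR by metis
    have "cross2 w (b - x) = \<beta> * cross2 (a - x) (b - x) + \<alpha> * cross2 (b - x) (b - x)"
      unfolding w_def by (simp only: cross2_add_left cross2_scaleR_left)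
    also have "\<dots> = 0" using c by (simp add: cross2_self)
    finally have "cross2 w (b - x) = 0" .
    then have "cross2 u (b - x) = 0" by (simp add: s cross2_scaleR_left)
    then show False using b by simp
  qed
  then have "\<beta> *\<^sub>R a + \<alpha> *\<^sub>R b = (\<alpha> + \<beta>) *\<^sub>R x" by (simp add: w_def algebra_simps)
  then have "x = (1 / (\<alpha> + \<beta>)) *\<^sub>R (\<beta> *\<^sub>R a + \<alpha> *\<^sub>R b)" using pos by simp
  also have "\<dots> = (\<beta> / (\<alpha> + \<beta>)) *\<^sub>R a + (\<alpha> / (\<alpha> + \<beta>)) *\<^sub>R b" by (simp add: scaleR_add_right)
  also have "\<beta> / (\<alpha> + \<beta>) = 1 - \<alpha> / (\<alpha> + \<beta>)" using pos by (simp add: field_simps)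
  finally have "x = (1 - \<alpha> / (\<alpha> + \<beta>)) *\<^sub>R a + (\<alpha> / (\<alpha> + \<beta>)) *\<^sub>R b" .
  moreover have "0 \<le> \<alpha> / (\<alpha> + \<beta>)" "\<alpha> / (\<alpha> + \<beta>) \<le> 1"
    using a b pos by (auto simp: \<alpha>_def \<beta>_def)
  ultimately show ?thesis unfolding in_segment by blast
qed

lemma generic_direction:
  fixes A :: "(real^2) set"
  assumes "finite A" "0 \<notin> A"
  obtains u where "u \<noteq> 0" "\<And>a. a \<in> A \<Longrightarrow> cross2 u a \<noteq> 0"
proof -
  \<comment> \<open>For \<open>a$1 = 0\<close> the quotient is 0 by convention; this is harmless, as
    a direction with first coordinate 1 is not parallel to a nonzero vertical vector.\<close>
  obtain s where s: "s \<notin> (\<lambda>a. a$2 / a$1) ` A"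
    using ex_new_if_finite[OF infinite_UNIV_char_0 finite_imageI[OF assms(1)]] by blast
  let ?u = "vector [1, s] :: real^2"
  have "cross2 ?u a \<noteq> 0" if "a \<in> A" for a
  proof
    assume "cross2 ?u a = 0"
    then have e: "a$2 = s * a$1" by (simp add: cross2_def)
    have "a \<noteq> 0" using that assms(2) by blast
    then have "a$1 \<noteq> 0" using e by (auto simp: vec_eq_iff forall_2)
    then have "s = a$2 / a$1" using e by simp
    then show False using s that by blast
  qed
  moreover have "?u \<noteq> 0" by (auto simp: vec_eq_iff forall_2)
  ultimately show thesis using that by blast
qed

section \<open>The Maxwell--Cremona lift of a stress\<close>

lemma second_diff_abs_nonneg: "0 \<le> \<bar>c - t\<bar> + \<bar>c + t\<bar> - 2 * \<bar>c\<bar>" for c t :: real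
  by linarith

lemma second_diff_abs_eq_0: "\<bar>t\<bar> \<le> \<bar>c\<bar> \<Longrightarrow> \<bar>c - t\<bar> + \<bar>c + t\<bar> - 2 * \<bar>c\<bar> = 0" for c t :: real
  by linarith

locale self_stress =
  fixes n :: nat and p :: "nat \<Rightarrow> real^2" and \<omega> :: "nat \<Rightarrow> nat \<Rightarrow> real"
  assumes stress_sym: "\<omega> i j = \<omega> j i"
    and equilibrium: "i < n \<Longrightarrow> (\<Sum>j<n. \<omega> i j *\<^sub>R (p j - p i)) = 0"
begin

text \<open>Twice the signed area of the triangle \<open>x\<close>, \<open>p i\<close>,
  \<open>p j\<close>; equally, the moment about \<open>x\<close> of the force
  \<open>p j - p i\<close> acting at \<open>p i\<close>.\<close>

definition area :: "nat \<Rightarrow> nat \<Rightarrow> real^2 \<Rightarrow> real" where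
  "area i j x = cross2 (p i - x) (p j - x)"

text \<open>Points on the line count as left, so every vertex has exactly one side and no genericity
  of the line has to be assumed.\<close>

definition left :: "real^2 \<Rightarrow> real^2 \<Rightarrow> nat \<Rightarrow> bool" where
  "left u x i \<longleftrightarrow> 0 \<le> cross2 u (p i - x)"

text \<open>The direction of the separating line is kept as a parameter; once
  \<open>lift_direction\<close> is proved, it can be chosen afresh at each point. Each unordered
  pair is counted twice.\<close>

definition lift :: "real^2 \<Rightarrow> real^2 \<Rightarrow> real" where
  "lift u x = (\<Sum>i<n. \<Sum>j<n. \<omega> i j * (of_bool (left u x i \<noteq> left u x j) * \<bar>area i j x\<bar>))"

lemma area_swap: "area j i x = - area i j x"
  unfolding area_def by (rule cross2_commute)

lemma area_shift: "area i j (x + t *\<^sub>R u) = area i j x - t * cross2 u (p j - p i)"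
  unfolding area_def by (simp add: cross2_def algebra_simps)

lemma left_shift: "left u (x + t *\<^sub>R u) = left u x"
  unfolding left_def by (simp add: fun_eq_iff cross2_linear)

lemma torque_balance:
  assumes "i < n"
  shows "(\<Sum>j<n. \<omega> i j * area i j x) = 0"
proof -
  have "(\<Sum>j<n. \<omega> i j * area i j x) = cross2 (p i - x) (\<Sum>j<n. \<omega> i j *\<^sub>R (p j - p i))"
    unfolding cross2_sum_right area_def
    by (intro sum.cong refl) (simp add: cross2_def algebra_simps)
  then show ?thesis using equilibrium[OF assms] by (simp add: cross2_linear)
qed

text \<open>Let \<open>S\<close> be the set of vertices that change side when the line turns from
  \<open>u\<close> to \<open>u'\<close>. A pair with both or neither end in \<open>S\<close> keeps
  its separation status. For a pair with one end in \<open>S\<close>, the change of the term is the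
  signed area up to a common sign. The difference of the two lifts is thus a combination of the
  total moments at the vertices of \<open>S\<close>, each zero by
  \<open>torque_balance\<close>.\<close>

lemma lift_direction_aux:
  assumes uu: "cross2 u u' \<noteq> 0"
  shows "lift u x = lift u' x"
proof -
  define S where "S = (\<lambda>i. left u x i \<noteq> left u' x i)"
  define e where "e = sgn (cross2 u u')"
  have e: "e = 1 \<and> cross2 u u' > 0 \<or> e = -1 \<and> cross2 u u' < 0"
    using uu by (auto simp: e_def sgn_if)
  have key: "(of_bool (left u x i \<noteq> left u x j) - of_bool (left u' x i \<noteq> left u' x j)) * \<bar>area i j x\<bar>
      = - e * area i j x" if "S i" "\<not> S j" for i j
  proof -
    let ?a = "p i - x" and ?b = "p j - x"
    \<comment> \<open>The four sides are known, so this relation determines the sign of the area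
      relative to the turn from \<open>u\<close> to \<open>u'\<close>.\<close>
    have pl: "cross2 u u' * area i j x = cross2 u ?a * cross2 u' ?b - cross2 u ?b * cross2 u' ?a"
      unfolding area_def by (rule cross2_Plucker)
    show ?thesis
    proof (cases "left u x i = left u x j")
      case True
      have "cross2 u ?a * cross2 u' ?b \<ge> 0" "cross2 u ?b * cross2 u' ?a \<le> 0"
        using True that
        by (auto simp: S_def left_def zero_le_mult_iff mult_le_0_iff not_le less_imp_le)
      then have "cross2 u u' * area i j x \<ge> 0" using pl by linarith
      then have "\<bar>area i j x\<bar> = e * area i j x"
        using e by (auto simp: zero_le_mult_iff)
      then show ?thesis using True that by (auto simp: S_def)
    next
      case False
      have "cross2 u ?a * cross2 u' ?b \<le> 0" "cross2 u ?b * cross2 u' ?a \<ge> 0"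
        using False that
        by (auto simp: S_def left_def zero_le_mult_iff mult_le_0_iff not_le less_imp_le)
      then have "cross2 u u' * area i j x \<le> 0" using pl by linarith
      then have "\<bar>area i j x\<bar> = - e * area i j x"
        using e by (auto simp: mult_le_0_iff)
      then show ?thesis using False that by (auto simp: S_def)
    qed
  qed
  have termwise: "(of_bool (left u x i \<noteq> left u x j) - of_bool (left u' x i \<noteq> left u' x j)) * \<bar>area i j x\<bar>
      = - e * (of_bool (S i) * area i j x + of_bool (S j) * area j i x)" for i j
  proof (cases "S i = S j")
    case True
    then show ?thesis using area_swap[of j i x] by (auto simp: S_def)
  next
    case False
    then show ?thesis using key[of i j] key[of j i] area_swap[of j i x] by auto
  qed
  have "lift u x - lift u' x = (\<Sum>i<n. \<Sum>j<n. \<omega> i j *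
      ((of_bool (left u x i \<noteq> left u x j) - of_bool (left u' x i \<noteq> left u' x j)) * \<bar>area i j x\<bar>))"
    unfolding lift_def sum_subtractf[symmetric]
    by (intro sum.cong refl) (simp only: left_diff_distrib right_diff_distrib)
  also have "\<dots> = (\<Sum>i<n. \<Sum>j<n. - e * of_bool (S i) * (\<omega> i j * area i j x)
      + - e * of_bool (S j) * (\<omega> j i * area j i x))"
    unfolding termwise by (intro sum.cong refl) (simp add: stress_sym[of _ i for i] algebra_simps)
  also have "\<dots> = (\<Sum>i<n. - e * of_bool (S i) * (\<Sum>j<n. \<omega> i j * area i j x))
      + (\<Sum>j<n. - e * of_bool (S j) * (\<Sum>i<n. \<omega> j i * area j i x))"
    unfolding sum.distrib sum_distrib_left
    by (rule arg_cong2[where f="(+)"], rule refl, rule sum.swap)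
  also have "\<dots> = 0" by (simp add: torque_balance)
  finally show ?thesis by simp
qed

text \<open>Parallel directions are compared through \<open>perp u\<close>, which is transverse to
  both.\<close>

lemma lift_direction:
  assumes "u \<noteq> 0" "u' \<noteq> 0"
  shows "lift u x = lift u' x"
proof (cases "cross2 u u' = 0")
  case True
  then obtain t where t: "u' = t *\<^sub>R u" using assms cross2_eq_0_scaleR by blast
  have "cross2 u' (perp u) \<noteq> 0"
    using t assms cross2_perp_pos[of u] by (auto simp: cross2_linear)
  then show ?thesis
    using lift_direction_aux[of u "perp u" x] lift_direction_aux[of u' "perp u" x]
      cross2_perp_pos[OF assms(1)] by simp
qed (rule lift_direction_aux)

text \<open>A generic line through \<open>x\<close> meets no vertex other than those at
  \<open>x\<close> itself. Near \<open>x\<close> the sides of all other vertices are constant, and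
  the terms of a vertex at \<open>x\<close> tend to 0 with their area.\<close>

lemma continuous_lift:
  assumes u: "u \<noteq> 0"
  shows "isCont (lift u) x"
proof -
  let ?A = "(\<lambda>i. p i - x) ` {i. i < n \<and> p i \<noteq> x}"
  obtain w where w: "w \<noteq> 0" "\<And>a. a \<in> ?A \<Longrightarrow> cross2 w a \<noteq> 0"
    by (rule generic_direction[of ?A]) auto
  have "lift u = lift w" using lift_direction[OF u w(1)] by blast
  have loc: "eventually (\<lambda>y. left w y i = left w x i) (at x)" if "i < n" "p i \<noteq> x" for i
  proof -
    have c: "isCont (\<lambda>y. cross2 w (p i - y)) x" by (intro continuous_intros)
    have "cross2 w (p i - x) \<noteq> 0" using w(2) that by blast
    then consider "cross2 w (p i - x) > 0" | "cross2 w (p i - x) < 0" by linarith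
    then show ?thesis
    proof cases
      case 1
      then have "eventually (\<lambda>y. cross2 w (p i - y) > 0) (at x)"
        using c order_tendstoD(1) unfolding isCont_def by blast
      then show ?thesis using 1 by (auto elim!: eventually_mono simp: left_def)
    next
      case 2
      then have "eventually (\<lambda>y. cross2 w (p i - y) < 0) (at x)"
        using c order_tendstoD(2) unfolding isCont_def by blast
      then show ?thesis using 2 by (auto elim!: eventually_mono simp: left_def)
    qed
  qed
  have ca: "isCont (\<lambda>y. \<bar>area i j y\<bar>) x" for i j
    unfolding area_def by (intro continuous_intros)
  have "isCont (\<lambda>y. of_bool (left w y i \<noteq> left w y j) * \<bar>area i j y\<bar>) x" if "i < n" "j < n" for i j
  proof (cases "p i = x \<or> p j = x")
    case True
    then have 0: "area i j x = 0" by (auto simp: area_def cross2_linear)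
    have "((\<lambda>y. \<bar>area i j y\<bar>) \<longlongrightarrow> 0) (at x)" using ca[of i j] 0 by (simp add: isCont_def)
    then have "((\<lambda>y. of_bool (left w y i \<noteq> left w y j) * \<bar>area i j y\<bar>) \<longlongrightarrow> 0) (at x)"
      by (rule Lim_null_comparison[rotated]) simp
    then show ?thesis using 0 by (simp add: isCont_def)
  next
    case False
    have "eventually (\<lambda>y. \<bar>area i j y\<bar> * of_bool (left w x i \<noteq> left w x j) =
        of_bool (left w y i \<noteq> left w y j) * \<bar>area i j y\<bar>) (at x)"
      by (rule eventually_mono[OF eventually_conj[OF loc[of i] loc[of j]]]) (use False that in auto)
    moreover have "((\<lambda>y. \<bar>area i j y\<bar> * of_bool (left w x i \<noteq> left w x j)) \<longlongrightarrow>
        \<bar>area i j x\<bar> * of_bool (left w x i \<noteq> left w x j)) (at x)"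
      using ca[of i j] unfolding isCont_def by (rule tendsto_mult_right)
    ultimately show ?thesis unfolding isCont_def
      by (simp add: Lim_transform_eventually mult.commute)
  qed
  then have "isCont (lift w) x"
    unfolding lift_def by (auto intro!: continuous_sum isCont_mult[OF continuous_const])
  then show ?thesis using \<open>lift u = lift w\<close> by simp
qed

lemma lift_eq_0:
  assumes "u \<noteq> 0" "w \<noteq> 0" "\<And>i. i < n \<Longrightarrow> left w x i"
  shows "lift u x = 0"
  using lift_direction[OF assms(1,2)] assms(3) by (simp add: lift_def)

text \<open>The line through \<open>x\<close> perpendicular to the position vector of
  \<open>x\<close> supports a disc around the origin that contains all vertices. For
  \<open>x = 0\<close> all vertices coincide with the origin and every area vanishes.\<close>

lemma lift_eq_0_outside:
  assumes u: "u \<noteq> 0" and x: "\<And>i. i < n \<Longrightarrow> norm (p i) \<le> norm x"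
  shows "lift u x = 0"
proof (cases "x = 0")
  case True
  then have "p i = 0" if "i < n" for i using x that by force
  then show ?thesis using True by (simp add: lift_def area_def cross2_linear)
next
  case False
  have "left (perp x) x i" if "i < n" for i
  proof -
    have "cross2 (perp x) (p i - x) = inner x x - inner x (p i)"
      by (simp add: cross2_def perp_def inner_vec_def UNIV_2 algebra_simps)
    moreover have "inner x (p i) \<le> norm x * norm (p i)" by (rule norm_cauchy_schwarz)
    moreover have "norm x * norm (p i) \<le> norm x * norm x" using x that by (simp add: mult_left_mono)
    ultimately show ?thesis by (simp add: left_def dot_square_norm power2_eq_square)
  qed
  then show ?thesis using lift_eq_0[OF u perp_nonzero[OF False]] by blast
qed

text \<open>Measured along the line that defines the separation, the lift is a sum of absolute values of
  affine functions.\<close>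

lemma lift_second_diff:
  assumes "w \<noteq> 0" "u \<noteq> 0"
  shows "lift w (x + t *\<^sub>R u) + lift w (x - t *\<^sub>R u) - 2 * lift w x =
    (\<Sum>i<n. \<Sum>j<n. \<omega> i j * (of_bool (left u x i \<noteq> left u x j) *
       (\<bar>area i j x - t * cross2 u (p j - p i)\<bar> + \<bar>area i j x + t * cross2 u (p j - p i)\<bar>
         - 2 * \<bar>area i j x\<bar>)))"
proof -
  have m: "x - t *\<^sub>R u = x + (- t) *\<^sub>R u" by simp
  have "lift w (x + t *\<^sub>R u) + lift w (x - t *\<^sub>R u) - 2 * lift w x =
      lift u (x + t *\<^sub>R u) + lift u (x - t *\<^sub>R u) - 2 * lift u x"
    using lift_direction[OF assms] by simp
  also have "\<dots> = (\<Sum>i<n. \<Sum>j<n. \<omega> i j * (of_bool (left u x i \<noteq> left u x j) *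
       (\<bar>area i j x - t * cross2 u (p j - p i)\<bar> + \<bar>area i j x + t * cross2 u (p j - p i)\<bar>
         - 2 * \<bar>area i j x\<bar>)))"
    unfolding m lift_def left_shift area_shift sum_distrib_left
      sum.distrib[symmetric] sum_subtractf[symmetric]
    by (intro sum.cong refl) (simp add: algebra_simps)
  finally show ?thesis .
qed

text \<open>Within such a step no nonzero area changes sign, so only pairs collinear with
  \<open>x\<close> can contribute to the second difference of the lift.\<close>

lemma small_step:
  "\<exists>t>0. \<forall>i<n. \<forall>j<n. area i j x = 0 \<or> \<bar>t * cross2 u (p j - p i)\<bar> \<le> \<bar>area i j x\<bar>"
proof -
  have "eventually (\<lambda>t. area i j x = 0 \<or> \<bar>t * cross2 u (p j - p i)\<bar> \<le> \<bar>area i j x\<bar>) (at_right 0)"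
    for i j
  proof (cases "area i j x = 0")
    case False
    have "((\<lambda>t. \<bar>t * cross2 u (p j - p i)\<bar>) \<longlongrightarrow> \<bar>0 * cross2 u (p j - p i)\<bar>) (at_right 0)"
      by (intro tendsto_intros)
    then have "eventually (\<lambda>t. \<bar>t * cross2 u (p j - p i)\<bar> < \<bar>area i j x\<bar>) (at_right 0)"
      using False by (intro order_tendstoD) auto
    then show ?thesis by (rule eventually_mono) simp
  qed simp
  then have "eventually (\<lambda>t. \<forall>i\<in>{..<n}. \<forall>j\<in>{..<n}. area i j x = 0 \<or>
      \<bar>t * cross2 u (p j - p i)\<bar> \<le> \<bar>area i j x\<bar>) (at_right (0::real))"
    by (intro eventually_ball_finite ballI) auto
  then have "eventually (\<lambda>t. t > 0 \<and> (\<forall>i\<in>{..<n}. \<forall>j\<in>{..<n}. area i j x = 0 \<or>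
      \<bar>t * cross2 u (p j - p i)\<bar> \<le> \<bar>area i j x\<bar>)) (at_right (0::real))"
    using eventually_at_right_less by eventually_elim auto
  then show ?thesis using eventually_happens[of _ "at_right (0::real)"] trivial_limit_at_right_real
    by fastforce
qed

lemma separated_imp_segment:
  assumes "area i j x = 0" "left u x i \<noteq> left u x j"
  shows "x \<in> closed_segment (p i) (p j)"
proof (cases "left u x i")
  case True
  then show ?thesis using assms unfolding area_def left_def
    by (intro cross2_zero_imp_segment[of _ _ _ u]) auto
next
  case False
  then have "x \<in> closed_segment (p j) (p i)"
    using assms area_swap[of j i x] unfolding area_def left_def
    by (intro cross2_zero_imp_segment[of _ _ _ u]) auto
  then show ?thesis by (simp add: closed_segment_commute)
qed

end

section \<open>Extreme vectors in a half-plane\<close>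

text \<open>One step of gift wrapping; \<open>s\<close> selects which end of the half-plane to the
  left of \<open>d\<close> is approached. A vector along \<open>D\<close> is extreme at once.
  Otherwise \<open>b\<close> maximises \<open>r\<close>, a multiple of the cotangent of the angle
  with \<open>D\<close>, and so minimises that angle; vectors outside \<open>B\<close> are zero or
  point along \<open>- D\<close>.\<close>

lemma extreme_direction:
  fixes A :: "(real^2) set" and s :: real
  assumes A: "finite A" and d: "\<And>a. a \<in> A \<Longrightarrow> 0 \<le> cross2 d a" "\<exists>a\<in>A. 0 < cross2 d a" and s: "s = 1 \<or> s = -1"
  obtains b where "b \<in> A" "b \<noteq> 0" "\<And>a. a \<in> A \<Longrightarrow> 0 \<le> s * cross2 b a"
proof -
  define D where "D = s *\<^sub>R d"
  have D0: "D \<noteq> 0" using d(2) s by (auto simp: D_def cross2_linear)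
  have sD: "s * cross2 D a = cross2 d a" for a using s by (auto simp: D_def cross2_linear)
  show thesis
  proof (cases "\<exists>b\<in>A. \<exists>t>0. b = t *\<^sub>R D")
    case True
    then obtain b t where b: "b \<in> A" "t > 0" "b = t *\<^sub>R D" by blast
    have "0 \<le> s * cross2 b a" if "a \<in> A" for a
    proof -
      have "s * cross2 b a = t * cross2 d a" unfolding sD[symmetric] b(3) by (simp add: cross2_linear)
      then show ?thesis using d(1)[OF that] b(2) by simp
    qed
    then show thesis using that b D0 by auto
  next
    case False
    define B where "B = {a \<in> A. 0 < cross2 d a}"
    define r where "r = (\<lambda>a. inner D a / cross2 d a)"
    have "finite B" "B \<noteq> {}" using A d(2) by (auto simp: B_def)
    then have "Max (r ` B) \<in> r ` B" "\<And>a. a \<in> B \<Longrightarrow> r a \<le> Max (r ` B)" by auto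
    then obtain b where b: "b \<in> B" "\<And>a. a \<in> B \<Longrightarrow> r a \<le> r b" by force
    have bA: "b \<in> A" "0 < cross2 d b" using b(1) by (auto simp: B_def)
    have "0 \<le> s * cross2 b a" if a: "a \<in> A" for a
    proof (cases "a \<in> B")
      case True
      then have pos: "0 < cross2 d a" by (simp add: B_def)
      have "inner D a * cross2 d b \<le> inner D b * cross2 d a"
        using b(2)[OF True] pos bA by (simp add: r_def divide_simps mult.commute)
      moreover have "inner D D * (s * cross2 b a) = inner D b * (s * cross2 D a) - inner D a * (s * cross2 D b)"
        by (simp add: inner_vec_def UNIV_2 cross2_def algebra_simps)
      ultimately have "0 \<le> inner D D * (s * cross2 b a)" unfolding sD by simp
      moreover have "inner D D > 0" using D0 by simp
      ultimately show ?thesis by (simp add: zero_le_mult_iff)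
    next
      case F: False
      then have "cross2 d a = 0" using d(1) a by (force simp: B_def)
      then have "cross2 D a = 0" by (simp add: D_def cross2_linear)
      then obtain t where t: "a = t *\<^sub>R D" using D0 cross2_eq_0_scaleR by blast
      then have "\<not> t > 0" using False a by blast
      then have "t \<le> 0" by simp
      moreover have "s * cross2 b a = - t * cross2 d b"
        unfolding sD[symmetric] t using cross2_commute[of b D] by (simp add: cross2_linear)
      ultimately show ?thesis using bA by (simp add: mult_nonpos_nonneg)
    qed
    then show thesis using that bA by (metis cross2_0_right less_irrefl)
  qed
qed

section \<open>The maximum principle for a stressed linkage\<close>

text \<open>The common setting of arcs and polygons, to be refuted for each in turn. Absence of
  crossings enters through \<open>vertex_on_bar\<close> and \<open>bars_meet\<close>.\<close>

locale stressed_linkage = self_stress +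
  fixes E :: "(nat \<times> nat) set"
  assumes inj: "inj_on p {..<n}"
    and E_sub: "E \<subseteq> {..<n} \<times> {..<n}"
    and strut_pos: "i < n \<Longrightarrow> j < n \<Longrightarrow> \<not> bar E i j \<Longrightarrow> 0 < \<omega> i j"
    and two_neighbours: "i < n \<Longrightarrow> \<exists>k l. \<forall>j. bar E i j \<longrightarrow> j = k \<or> j = l"
    and vertex_on_bar: "i < n \<Longrightarrow> bar E a b \<Longrightarrow> p i \<in> closed_segment (p a) (p b) \<Longrightarrow> i = a \<or> i = b"
    and bars_meet: "bar E a b \<Longrightarrow> bar E c d \<Longrightarrow> x \<in> closed_segment (p a) (p b) \<Longrightarrow>
      x \<in> closed_segment (p c) (p d) \<Longrightarrow> x \<notin> p ` {..<n} \<Longrightarrow> {a, b} = {c, d}"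
    and not_collinear: "\<not> collinear (p ` {..<n})"
begin

lemma bar_less: "bar E i j \<Longrightarrow> i < n \<and> j < n"
  using E_sub by (auto simp: bar_def)

lemma bar_sym: "bar E i j \<Longrightarrow> bar E j i"
  by (auto simp: bar_def)

text \<open>At a vertex, a direction along one bar and with the other bar to its left works; the half-open
  convention in \<open>left\<close> then counts both bars as not separated.\<close>

lemma unseparating_direction:
  obtains u where "u \<noteq> 0"
    "\<And>i j. bar E i j \<Longrightarrow> x \<in> closed_segment (p i) (p j) \<Longrightarrow> left u x i = left u x j"
proof (cases "x \<in> p ` {..<n}")
  case True
  then obtain i where i: "i < n" "x = p i" by blast
  obtain k l where kl: "\<And>j. bar E i j \<Longrightarrow> j = k \<or> j = l" using two_neighbours[OF i(1)] by blast
  define u0 where "u0 = (if p k \<noteq> x then p k - x else axis 1 1)"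
  define u where "u = (if cross2 u0 (p l - x) \<ge> 0 then u0 else - u0)"
  have u0: "u0 \<noteq> 0" "cross2 u0 (p k - x) = 0"
    by (simp_all add: u0_def cross2_self cross2_0_right axis_eq_0_iff)
  have u: "u \<noteq> 0" using u0 by (simp add: u_def)
  have L: "left u x j" if "j = i \<or> j = k \<or> j = l" for j
    using that u0(2) i(2) by (auto simp: left_def u_def cross2_minus_left cross2_0_right)
  have "left u x a = left u x b" if ab: "bar E a b" "x \<in> closed_segment (p a) (p b)" for a b
  proof -
    have "a = i \<or> b = i" using vertex_on_bar[OF i(1) ab(1)] ab(2) i(2) by auto
    then show ?thesis using kl[of a] kl[of b] ab bar_sym L by auto
  qed
  then show thesis using that u by blast
next
  case False
  show thesis
  proof (cases "\<exists>a b. bar E a b \<and> a \<noteq> b \<and> x \<in> closed_segment (p a) (p b)")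
    case True
    then obtain a b where ab: "bar E a b" "a \<noteq> b" "x \<in> closed_segment (p a) (p b)" by blast
    \<comment> \<open>Away from the vertices only one bar can pass through \<open>x\<close>; taken
      along it, the line contains both its ends, which then count as left.\<close>
    define u where "u = p b - p a"
    have u: "u \<noteq> 0" using ab bar_less[OF ab(1)] inj by (auto simp: u_def inj_on_def)
    obtain t where t: "x = (1 - t) *\<^sub>R p a + t *\<^sub>R p b" using ab(3) by (auto simp: in_segment)
    have "left u x a" "left u x b"
      unfolding left_def u_def t by (simp_all add: cross2_def algebra_simps)
    then have "left u x i = left u x j" if "bar E i j" "x \<in> closed_segment (p i) (p j)" for i j
      using bars_meet[OF that(1) ab(1) that(2) ab(3) False] by (auto simp: doubleton_eq_iff)
    then show thesis using that u by blast
  next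
    case none: False
    show thesis
    proof (rule that[of "axis 1 1"])
      show "axis 1 1 \<noteq> (0::real^2)" by (simp add: axis_eq_0_iff)
      show "left (axis 1 1) x i = left (axis 1 1) x j"
        if "bar E i j" "x \<in> closed_segment (p i) (p j)" for i j using none that by auto
    qed
  qed
qed

text \<open>Along an unseparating direction a bar contributes nothing: either it is not separated,
  or its area keeps its sign during a small step. Every other pair has positive stress, and the
  absolute value is convex.\<close>

lemma lift_midpoint_convex:
  assumes "w \<noteq> 0"
  obtains u t where "u \<noteq> 0" "t > 0" "2 * lift w x \<le> lift w (x + t *\<^sub>R u) + lift w (x - t *\<^sub>R u)"
proof -
  obtain u where u: "u \<noteq> 0"
    "\<And>i j. bar E i j \<Longrightarrow> x \<in> closed_segment (p i) (p j) \<Longrightarrow> left u x i = left u x j"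
    using unseparating_direction[of x] by blast
  obtain t where t: "t > 0"
    "\<And>i j. i < n \<Longrightarrow> j < n \<Longrightarrow> area i j x = 0 \<or> \<bar>t * cross2 u (p j - p i)\<bar> \<le> \<bar>area i j x\<bar>"
    using small_step[of x u] by blast
  have "0 \<le> lift w (x + t *\<^sub>R u) + lift w (x - t *\<^sub>R u) - 2 * lift w x"
    unfolding lift_second_diff[OF assms u(1)]
  proof (intro sum_nonneg)
    fix i j assume ij: "i \<in> {..<n}" "j \<in> {..<n}"
    let ?d = "\<bar>area i j x - t * cross2 u (p j - p i)\<bar> + \<bar>area i j x + t * cross2 u (p j - p i)\<bar>
         - 2 * \<bar>area i j x\<bar>"
    show "0 \<le> \<omega> i j * (of_bool (left u x i \<noteq> left u x j) * ?d)"
    proof (cases "bar E i j")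
      case True
      show ?thesis
      proof (cases "area i j x = 0")
        case zero: True
        then have "left u x i = left u x j"
          using u(2)[OF True] separated_imp_segment[OF zero] by blast
        then show ?thesis by simp
      next
        case False
        then have "?d = 0" using t(2) ij by (intro second_diff_abs_eq_0) auto
        then show ?thesis by simp
      qed
    next
      case False
      then have "0 < \<omega> i j" using strut_pos ij by simp
      then show ?thesis using second_diff_abs_nonneg by (simp add: zero_le_mult_iff)
    qed
  qed
  then show thesis using that u(1) t(1) by force
qed

text \<open>Among the maximum points the one farthest from the origin cannot be the midpoint of two others.\<close>

lemma lift_nonpos:
  assumes w: "w \<noteq> 0"
  shows "lift w y \<le> 0"
proof (rule ccontr)
  assume "\<not> lift w y \<le> 0"
  then have y: "lift w y > 0" by simp
  define R where "R = (\<Sum>i<n. norm (p i))"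
  have R: "norm (p i) \<le> R" if "i < n" for i
    unfolding R_def using that by (intro member_le_sum) auto
  have out: "norm x < R" if "lift w x > 0" for x
  proof (rule ccontr)
    assume "\<not> norm x < R"
    then have "lift w x = 0" using R by (intro lift_eq_0_outside[OF w]) force
    then show False using that by simp
  qed
  have cont: "continuous_on S (lift w)" for S
    using continuous_lift[OF w] by (simp add: continuous_at_imp_continuous_on)
  have "\<exists>x\<in>cball 0 R. \<forall>z\<in>cball 0 R. lift w z \<le> lift w x"
  proof (rule continuous_attains_sup[OF compact_cball _ cont])
    have "y \<in> cball 0 R" using out[OF y] by simp
    then show "cball 0 R \<noteq> ({} :: (real^2) set)" by blast
  qed
  then obtain m where m: "\<And>z. norm z \<le> R \<Longrightarrow> lift w z \<le> lift w m"
    by (metis mem_cball_0)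
  have mpos: "lift w m > 0" using m[of y] out[OF y] y by auto
  have max: "lift w z \<le> lift w m" for z
    using m[of z] out[of z] mpos by (cases "lift w z > 0") auto
  define K where "K = cball 0 R \<inter> lift w -` {lift w m}"
  have "compact K"
    unfolding K_def using cont by (intro compact_Int_closed closed_vimage_Int compact_cball)
      (auto intro!: continuous_closed_vimage continuous_lift[OF w])
  moreover have "m \<in> K" using out[OF mpos] by (auto simp: K_def)
  ultimately obtain x where x: "x \<in> K" "\<And>z. z \<in> K \<Longrightarrow> norm z \<le> norm x"
    using continuous_attains_sup[of K norm] by (metis empty_iff continuous_on_norm_id)
  have xm: "lift w x = lift w m" using x(1) by (simp add: K_def)
  obtain u t where u: "u \<noteq> 0" "t > 0" "2 * lift w x \<le> lift w (x + t *\<^sub>R u) + lift w (x - t *\<^sub>R u)"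
    using lift_midpoint_convex[OF w] by blast
  have "lift w (x + t *\<^sub>R u) = lift w m" "lift w (x - t *\<^sub>R u) = lift w m"
    using u(3) max[of "x + t *\<^sub>R u"] max[of "x - t *\<^sub>R u"] xm by linarith+
  then have "x + t *\<^sub>R u \<in> K" "x - t *\<^sub>R u \<in> K"
    using out[of "x + t *\<^sub>R u"] out[of "x - t *\<^sub>R u"] mpos by (auto simp: K_def)
  then have "norm (x + t *\<^sub>R u) \<le> norm x" "norm (x - t *\<^sub>R u) \<le> norm x" using x(2) by auto
  then have "(norm (x + t *\<^sub>R u))\<^sup>2 + (norm (x - t *\<^sub>R u))\<^sup>2 \<le> 2 * (norm x)\<^sup>2"
    using power_mono[of _ "norm x" 2] by (smt (verit) norm_ge_zero)
  \<comment> \<open>The parallelogram law: two points symmetric about \<open>x\<close> cannot both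
    be as close to the origin as \<open>x\<close>.\<close>
  moreover have "(norm (x + t *\<^sub>R u))\<^sup>2 + (norm (x - t *\<^sub>R u))\<^sup>2 = 2 * (norm x)\<^sup>2 + 2 * (norm (t *\<^sub>R u))\<^sup>2"
    by (simp only: power2_norm_eq_inner) (simp add: algebra_simps inner_commute)
  moreover have "(norm (t *\<^sub>R u))\<^sup>2 > 0" using u by simp
  ultimately show False by linarith
qed

section \<open>Edges of the convex hull\<close>

text \<open>The sign \<open>s\<close> chooses one of the two hull directions \<open>w\<close> at
  \<open>p i\<close>. If no bar leaves \<open>p i\<close> along \<open>w\<close>, take
  \<open>x\<close> on this ray just after \<open>p i\<close>. The lift vanishes at \<open>x\<close>
  and outside the hull, but has a strictly convex crease at \<open>x\<close>, so it is positive just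
  inside, against \<open>lift_nonpos\<close>.\<close>

lemma hull_bar:
  assumes i: "i < n" and d: "d \<noteq> 0" "\<And>k. k < n \<Longrightarrow> 0 \<le> cross2 d (p k - p i)" and s: "s = 1 \<or> s = -1"
  obtains j where "bar E i j" "j \<noteq> i" "\<And>k. k < n \<Longrightarrow> 0 \<le> s * cross2 (p j - p i) (p k - p i)"
proof -
  have "\<exists>k<n. cross2 d (p k - p i) > 0"
  proof (rule ccontr)
    assume "\<not> ?thesis"
    then have z: "cross2 d (p k - p i) = 0" if "k < n" for k using d(2) that by force
    have "cross2 d (p k - p l) = 0" if "k < n" "l < n" for k l
      using z[OF that(1)] z[OF that(2)] by (simp add: cross2_linear)
    then have "collinear (p ` {..<n})"
      unfolding collinear_def using cross2_eq_0_scaleR[OF d(1)] by (intro exI[of _ d]) (auto, metis)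
    then show False using not_collinear by blast
  qed
  then obtain w where w: "w \<in> (\<lambda>k. p k - p i) ` {..<n}" "w \<noteq> 0"
    "\<And>a. a \<in> (\<lambda>k. p k - p i) ` {..<n} \<Longrightarrow> 0 \<le> s * cross2 w a"
    using extreme_direction[of "(\<lambda>k. p k - p i) ` {..<n}" d s] d(2) s by auto
  have side: "0 \<le> s * cross2 w (p k - p i)" if "k < n" for k using w(3) that by blast
  obtain j where j: "j < n" "w = p j - p i" using w(1) by blast
  have ij: "i \<noteq> j" using w(2) j by auto
  show thesis
  \<comment> \<open>Several vertices may lie on the ray, so the bar sought need not end at
    \<open>j\<close>.\<close>
  proof (cases "\<exists>k t. bar E i k \<and> t > 0 \<and> p k - p i = t *\<^sub>R w")
    case True
    then obtain k t where k: "bar E i k" "t > 0" "p k - p i = t *\<^sub>R w" by blast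
    have "k \<noteq> i" using k w(2) by auto
    moreover have "0 \<le> s * cross2 (p k - p i) (p l - p i)" if "l < n" for l
    proof -
      have "s * cross2 (p k - p i) (p l - p i) = t * (s * cross2 w (p l - p i))"
        unfolding k(3) by (simp add: cross2_scaleR_left)
      then show ?thesis using side[OF that] k(2) by (metis less_imp_le mult_nonneg_nonneg)
    qed
    ultimately show thesis using that k(1) by blast
  next
    case none: False
    \<comment> \<open>\<open>P\<close> lists the positions of vertices on the open ray;
      \<open>\<epsilon>\<close> is chosen below all of them and below 1, the position of
      \<open>j\<close>.\<close>
    define P where "P = {t. \<exists>k<n. 0 < t \<and> p k - p i = t *\<^sub>R w}"
    have "P \<subseteq> (\<lambda>k. inner (p k - p i) w / inner w w) ` {..<n}"
    proof
      fix t assume "t \<in> P"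
      then obtain k where "k < n" "p k - p i = t *\<^sub>R w" by (auto simp: P_def)
      then show "t \<in> (\<lambda>k. inner (p k - p i) w / inner w w) ` {..<n}"
        using w(2) by (intro image_eqI[of _ _ k]) auto
    qed
    then have finP: "finite P" using finite_surj by blast
    define \<epsilon> where "\<epsilon> = Min (insert 1 P) / 2"
    have minP: "Min (insert 1 P) > 0" using finP by (auto simp: P_def)
    have \<epsilon>P: "\<epsilon> < t" if "t \<in> P" for t
    proof -
      have "Min (insert 1 P) \<le> t" using finP that by simp
      then show ?thesis using minP by (simp add: \<epsilon>_def)
    qed
    have "Min (insert 1 P) \<le> 1" using finP by simp
    then have \<epsilon>: "0 < \<epsilon>" "\<epsilon> < 1" using minP by (simp_all add: \<epsilon>_def)
    define x where "x = p i + \<epsilon> *\<^sub>R w"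
    have cw: "s * cross2 w (p k - x) = s * cross2 w (p k - p i)" for k
      by (simp add: x_def cross2_linear)
    \<comment> \<open>The normal to the supporting line that points out of the hull.\<close>
    define m where "m = (- s) *\<^sub>R perp w"
    have m0: "m \<noteq> 0" using perp_nonzero[OF w(2)] s by (auto simp: m_def)
    have wm: "s * cross2 w m < 0" using cross2_perp_pos[OF w(2)] s by (auto simp: m_def cross2_linear)
    \<comment> \<open>Such a bar would contain \<open>x\<close>. As the hull lies on one side, both
      ends are on the line along \<open>w\<close>. No vertex lies between \<open>p i\<close> and
      \<open>x\<close>, so the bar also contains \<open>p i\<close>, which must be one of its ends;
      the other end then yields a bar along \<open>w\<close>, excluded by
      \<open>none\<close>.\<close>
    have nocross: "\<not> bar E k l" if kl: "k < n" "l < n" "area k l x = 0" "left m x k \<noteq> left m x l" for k l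
    proof
      assume b: "bar E k l"
      have "x \<in> closed_segment (p k) (p l)" using separated_imp_segment kl by blast
      then obtain t where t: "x = (1 - t) *\<^sub>R p k + t *\<^sub>R p l" "0 \<le> t" "t \<le> 1"
        by (auto simp: in_segment)
      have notx: "p a \<noteq> x" if "a < n" for a
      proof
        assume "p a = x"
        then have "\<epsilon> \<in> P" using that \<epsilon> by (auto simp: P_def x_def)
        then show False using \<epsilon>P by blast
      qed
      then have "t \<noteq> 0" "t \<noteq> 1" using t(1) notx[OF kl(1)] notx[OF kl(2)] by auto
      then have t01: "0 < t" "t < 1" using t(2,3) by auto
      have "(1 - t) * (s * cross2 w (p k - p i)) + t * (s * cross2 w (p l - p i)) =
          s * cross2 w ((1 - t) *\<^sub>R p k + t *\<^sub>R p l - p i)"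
        by (simp add: cross2_linear algebra_simps)
      also have "\<dots> = 0" unfolding t(1)[symmetric] by (simp add: x_def cross2_linear)
      finally have sum0: "(1 - t) * (s * cross2 w (p k - p i)) + t * (s * cross2 w (p l - p i)) = 0" .
      moreover have "0 \<le> (1 - t) * (s * cross2 w (p k - p i))" "0 \<le> t * (s * cross2 w (p l - p i))"
        using side kl(1,2) t by simp_all
      ultimately have "(1 - t) * (s * cross2 w (p k - p i)) = 0" "t * (s * cross2 w (p l - p i)) = 0"
        by linarith+
      then have "cross2 w (p k - p i) = 0" "cross2 w (p l - p i) = 0" using t01 s by auto
      then obtain \<alpha> \<beta> where ab: "p k - p i = \<alpha> *\<^sub>R w" "p l - p i = \<beta> *\<^sub>R w"
        using cross2_eq_0_scaleR[OF w(2)] by metis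
      have "\<epsilon> *\<^sub>R w = (1 - t) *\<^sub>R (p k - p i) + t *\<^sub>R (p l - p i)"
        using t(1) by (simp add: x_def algebra_simps)
      also have "\<dots> = ((1 - t) * \<alpha> + t * \<beta>) *\<^sub>R w" unfolding ab by (simp add: scaleR_add_left)
      finally have eps: "\<epsilon> = (1 - t) * \<alpha> + t * \<beta>" using w(2) by simp
      have out: "\<gamma> \<le> 0 \<or> \<epsilon> < \<gamma>" if "a < n" "p a - p i = \<gamma> *\<^sub>R w" for a \<gamma>
        using \<epsilon>P[of \<gamma>] that by (force simp: P_def)
      have opp: "\<alpha> \<le> 0 \<and> \<epsilon> < \<beta> \<or> \<beta> \<le> 0 \<and> \<epsilon> < \<alpha>"
      proof (rule ccontr)
        assume "\<not> ?thesis"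
        then have "\<alpha> \<le> 0 \<and> \<beta> \<le> 0 \<or> \<epsilon> < \<alpha> \<and> \<epsilon> < \<beta>" using out[OF kl(1) ab(1)] out[OF kl(2) ab(2)] by auto
        then show False
        proof
          assume "\<alpha> \<le> 0 \<and> \<beta> \<le> 0"
          then have "(1 - t) * \<alpha> \<le> 0" "t * \<beta> \<le> 0" using t01 by (auto simp: mult_nonneg_nonpos)
          then show False using eps \<epsilon> by linarith
        next
          assume "\<epsilon> < \<alpha> \<and> \<epsilon> < \<beta>"
          then have "(1 - t) * \<epsilon> < (1 - t) * \<alpha>" "t * \<epsilon> < t * \<beta>" using t01 by auto
          then show False using eps by (simp add: algebra_simps)
        qed
      qed
      have "p i \<in> closed_segment (p k) (p l)"
      proof -
        define r where "r = \<alpha> / (\<alpha> - \<beta>)"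
        have ne: "\<alpha> \<noteq> \<beta>" using opp \<epsilon> by auto
        have "(1 - r) * \<alpha> + r * \<beta> = 0" using ne by (simp add: r_def field_simps)
        then have "(1 - r) *\<^sub>R (p k - p i) + r *\<^sub>R (p l - p i) = 0"
          unfolding ab by (simp add: scaleR_add_left[symmetric])
        then have "p i = (1 - r) *\<^sub>R p k + r *\<^sub>R p l" by (simp add: algebra_simps)
        moreover have "0 \<le> r" "r \<le> 1" using opp \<epsilon> by (auto simp: r_def divide_simps)
        ultimately show ?thesis by (auto simp: in_segment)
      qed
      then consider "i = k" | "i = l" using vertex_on_bar[OF i b] by blast
      then show False
      proof cases
        case 1
        then have "\<alpha> = 0" using ab(1) w(2) by auto
        then have "\<beta> > 0" using opp \<epsilon> by auto
        then show False using none b 1 ab(2) by blast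
      next
        case 2
        then have "\<beta> = 0" using ab(2) w(2) by auto
        then have "\<alpha> > 0" using opp \<epsilon> by auto
        then show False using none bar_sym[OF b] 2 ab(1) by blast
      qed
    qed
    obtain t where t: "t > 0"
      "\<And>k l. k < n \<Longrightarrow> l < n \<Longrightarrow> area k l x = 0 \<or> \<bar>t * cross2 m (p l - p k)\<bar> \<le> \<bar>area k l x\<bar>"
      using small_step[of x m] by blast
    define T where "T = (\<lambda>k l. \<omega> k l * (of_bool (left m x k \<noteq> left m x l) *
      (\<bar>area k l x - t * cross2 m (p l - p k)\<bar> + \<bar>area k l x + t * cross2 m (p l - p k)\<bar>
         - 2 * \<bar>area k l x\<bar>)))"
    have T0: "0 \<le> T k l" if kl: "k < n" "l < n" for k l
    proof (cases "area k l x = 0 \<and> left m x k \<noteq> left m x l")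
      case True
      then have "0 < \<omega> k l" using nocross kl strut_pos by blast
      then show ?thesis using True by (simp add: T_def)
    next
      case False
      then show ?thesis using t(2)[OF kl] second_diff_abs_eq_0[of "t * cross2 m (p l - p k)" "area k l x"]
        by (auto simp: T_def)
    qed
    have mw: "cross2 m w \<noteq> 0" using wm cross2_commute[of m w] by auto
    have e1: "p i - x = (- \<epsilon>) *\<^sub>R w" "p j - x = (1 - \<epsilon>) *\<^sub>R w"
      using j(2) by (simp_all add: x_def algebra_simps)
    \<comment> \<open>The pair \<open>i\<close>, \<open>j\<close> straddles \<open>x\<close> and so,
      by \<open>nocross\<close>, is not a bar; its positive stress makes the crease strict.\<close>
    have Tij: "0 < T i j"
    proof -
      have a0: "area i j x = 0" unfolding area_def e1 by (simp add: cross2_linear)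
      have "cross2 m (p i - x) = - \<epsilon> * cross2 m w" "cross2 m (p j - x) = (1 - \<epsilon>) * cross2 m w"
        unfolding e1 by (simp_all add: cross2_linear)
      then have sep: "left m x i \<noteq> left m x j"
        using \<epsilon> mw by (auto simp: left_def zero_le_mult_iff mult_le_0_iff)
      then have "0 < \<omega> i j" using nocross strut_pos i j(1) a0 by blast
      then show ?thesis using sep a0 t(1) mw j(2) by (simp add: T_def)
    qed
    have "0 < (\<Sum>k<n. \<Sum>l<n. T k l)"
    proof (rule sum_pos2[of _ i])
      show "0 < (\<Sum>l<n. T i l)" using Tij T0 i j(1) by (intro sum_pos2[of _ j]) auto
    qed (use i T0 in \<open>auto intro: sum_nonneg\<close>)
    then have "0 < lift w (x + t *\<^sub>R m) + lift w (x - t *\<^sub>R m) - 2 * lift w x"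
      unfolding lift_second_diff[OF w(2) m0] T_def .
    \<comment> \<open>Both points lie on or beyond the supporting line, so a line through them in
      direction \<open>s *\<^sub>R w\<close> has all vertices on its left.\<close>
    moreover have "lift w x = 0" "lift w (x + t *\<^sub>R m) = 0"
    proof -
      have sw: "s *\<^sub>R w \<noteq> 0" using s w(2) by auto
      have "s * cross2 w (p k - (x + t *\<^sub>R m)) = s * cross2 w (p k - x) + t * - (s * cross2 w m)" for k
        by (simp add: cross2_linear algebra_simps)
      moreover have "t * - (s * cross2 w m) > 0" using t(1) wm by (intro mult_pos_pos) auto
      ultimately have "0 \<le> s * cross2 w (p k - (x + t *\<^sub>R m))" if "k < n" for k
        using side[OF that] cw[of k] by (metis add_nonneg_nonneg less_imp_le)
      then have "left (s *\<^sub>R w) (x + t *\<^sub>R m) k" if "k < n" for k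
        unfolding left_def cross2_scaleR_left using that .
      then show "lift w (x + t *\<^sub>R m) = 0" using lift_eq_0[OF w(2) sw] by blast
      have "left (s *\<^sub>R w) x k" if "k < n" for k
        unfolding left_def cross2_scaleR_left using side[OF that] cw[of k] by metis
      then show "lift w x = 0" using lift_eq_0[OF w(2) sw] by blast
    qed
    ultimately have "0 < lift w (x - t *\<^sub>R m)" by simp
    then show thesis using lift_nonpos[OF w(2)] by (simp add: not_less[symmetric])
  qed
qed

text \<open>A supporting line passes through \<open>p i\<close>; the point need not be a corner of
  the hull.\<close>

definition hull_vertex :: "nat \<Rightarrow> bool" where
  "hull_vertex i \<longleftrightarrow> i < n \<and> (\<exists>d. d \<noteq> 0 \<and> (\<forall>k<n. 0 \<le> cross2 d (p k - p i)))"

text \<open>The condition of \<open>convex_polygon\<close> at a single edge.\<close>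

definition one_sided :: "nat \<Rightarrow> nat \<Rightarrow> bool" where
  "one_sided i j \<longleftrightarrow> (\<forall>k<n. cross2 (p j - p i) (p k - p i) \<ge> 0) \<or>
     (\<forall>k<n. cross2 (p j - p i) (p k - p i) \<le> 0)"

lemma one_sided_imp_hull_vertex:
  assumes "i < n" "j < n" "i \<noteq> j" "one_sided i j"
  shows "hull_vertex j"
proof -
  have ne: "p j - p i \<noteq> 0" using assms inj by (auto simp: inj_on_def)
  have e: "cross2 (p j - p i) (p k - p j) = cross2 (p j - p i) (p k - p i)" for k
    by (simp add: cross2_def algebra_simps)
  from assms(4) show ?thesis unfolding one_sided_def
  proof
    assume "\<forall>k<n. cross2 (p j - p i) (p k - p i) \<ge> 0"
    then show ?thesis unfolding hull_vertex_def
      using assms(2) ne e by (intro conjI exI[of _ "p j - p i"]) auto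
  next
    assume "\<forall>k<n. cross2 (p j - p i) (p k - p i) \<le> 0"
    then show ?thesis unfolding hull_vertex_def
      using assms(2) ne e
      by (intro conjI exI[of _ "- (p j - p i)"]) (auto simp only: cross2_minus_left neg_equal_0_iff_equal neg_0_le_iff_le)
  qed
qed

text \<open>The two signs in \<open>hull_bar\<close> give two bars. If they ended at the same
  vertex, all vertices would lie on both closed sides of one line, hence on that line.\<close>

lemma hull_vertex_two_bars:
  assumes "hull_vertex i"
  obtains j k where "j \<noteq> k" "bar E i j" "bar E i k" "hull_vertex j" "hull_vertex k"
    "one_sided i j" "one_sided i k"
proof -
  obtain d where i: "i < n" and d: "d \<noteq> 0" "\<And>k. k < n \<Longrightarrow> 0 \<le> cross2 d (p k - p i)"
    using assms by (auto simp: hull_vertex_def)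
  obtain j where j: "bar E i j" "j \<noteq> i" "\<And>k. k < n \<Longrightarrow> 0 \<le> 1 * cross2 (p j - p i) (p k - p i)"
    using hull_bar[OF i d, of 1] by blast
  obtain k where k: "bar E i k" "k \<noteq> i" "\<And>l. l < n \<Longrightarrow> 0 \<le> (-1) * cross2 (p k - p i) (p l - p i)"
    using hull_bar[OF i d, of "-1"] by blast
  have less: "j < n" "k < n" using bar_less j(1) k(1) by auto
  have os: "one_sided i j" "one_sided i k" using j(3) k(3) by (auto simp: one_sided_def)
  have "j \<noteq> k"
  proof
    assume "j = k"
    let ?w = "p j - p i"
    have w: "?w \<noteq> 0" using i less j(2) inj by (auto simp: inj_on_def)
    have z: "cross2 ?w (p l - p i) = 0" if "l < n" for l
      using j(3)[OF that] k(3)[OF that] \<open>j = k\<close> by simp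
    have "cross2 ?w (p l - p m) = 0" if "l < n" "m < n" for l m
    proof -
      have "cross2 ?w (p l - p m) = cross2 ?w (p l - p i) - cross2 ?w (p m - p i)"
        by (simp add: cross2_def algebra_simps)
      then show ?thesis using z that by simp
    qed
    then have "collinear (p ` {..<n})"
      unfolding collinear_def using cross2_eq_0_scaleR[OF w] by (intro exI[of _ ?w]) (auto, metis)
    then show False using not_collinear by blast
  qed
  moreover have "hull_vertex j" "hull_vertex k"
    using one_sided_imp_hull_vertex os i less j(2) k(2) by auto
  ultimately show thesis using that j(1) k(1) os by blast
qed

text \<open>A rightmost vertex has a vertical supporting line.\<close>

lemma hull_vertex_exists: "\<exists>i. hull_vertex i"
proof -
  have "n \<noteq> 0" using not_collinear by (metis collinear_empty image_empty lessThan_0)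
  define h where "h = (\<lambda>i. p i $ 1)"
  have "Max (h ` {..<n}) \<in> h ` {..<n}" using \<open>n \<noteq> 0\<close> by (intro Max_in) auto
  moreover have "h k \<le> Max (h ` {..<n})" if "k < n" for k using that by simp
  ultimately obtain i where i: "i < n" "\<And>k. k < n \<Longrightarrow> h k \<le> h i" by force
  let ?d = "vector [0, 1] :: real^2"
  have "?d \<noteq> 0" by (auto simp: vec_eq_iff forall_2)
  moreover have "0 \<le> cross2 ?d (p k - p i)" if "k < n" for k
    using i(2)[OF that] by (simp add: cross2_def h_def)
  ultimately show ?thesis using i(1) by (auto simp: hull_vertex_def)
qed

end

section \<open>Arcs and polygons\<close>

lemma non_crossing_bars:
  assumes "non_crossing n p E" "bar E a b" "bar E c d" "{a, b} \<noteq> {c, d}"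
  shows "closed_segment (p a) (p b) \<inter> closed_segment (p c) (p d) \<subseteq> p ` ({a, b} \<inter> {c, d})"
proof -
  have "closed_segment (p a) (p b) \<inter> closed_segment (p c) (p d) \<subseteq> p ` ({a,b} \<inter> {c,d})"
    if "(a,b) \<in> E" "(c,d) \<in> E" "{a,b} \<noteq> {c,d}" for a b c d
    using assms(1) that unfolding non_crossing_def by blast
  note X = this
  have sw: "closed_segment (p b) (p a) = closed_segment (p a) (p b)" "{b,a} = {a,b}" for a b
    by (auto simp: closed_segment_commute)
  show ?thesis
    using assms(2-4) X[of a b c d] X[of b a c d] X[of a b d c] X[of b a d c]
    unfolding bar_def sw(1)[of a b] sw(1)[of c d] sw(2)[of a b] sw(2)[of c d] by blast
qed

lemma flex_if_no_stressed_linkage: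
  assumes nc: "non_crossing n p E" and E: "E \<subseteq> {..<n} \<times> {..<n}"
    and nb: "\<And>i. i < n \<Longrightarrow> \<exists>j. bar E i j" "\<And>i. i < n \<Longrightarrow> \<exists>k l. \<forall>j. bar E i j \<longrightarrow> j = k \<or> j = l"
    and col: "\<not> collinear (p ` {..<n})"
    and no: "\<And>\<omega>. \<not> stressed_linkage n p \<omega> E"
  shows "\<exists>v :: nat \<Rightarrow> real^2. is_flex n p E v \<and> expansive n p v \<and>
           (\<exists>i<n. \<exists>j<n. strictly_expansive_on p v i j)"
proof (rule ccontr)
  assume none: "\<not> ?thesis"
  have inj: "inj_on p {..<n}" using nc by (simp add: non_crossing_def)
  have less: "a < n \<and> b < n" if "bar E a b" for a b using that E by (auto simp: bar_def)
  obtain \<omega> where \<omega>: "\<And>i j. \<omega> i j = \<omega> j i"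
    "\<And>i j. i < n \<Longrightarrow> j < n \<Longrightarrow> \<not> bar E i j \<Longrightarrow> 0 < \<omega> i j"
    "\<And>i. i < n \<Longrightarrow> (\<Sum>j<n. \<omega> i j *\<^sub>R (p j - p i)) = 0"
    using equilibrium_stress_exists[OF E none] by blast
  have "stressed_linkage n p \<omega> E"
  proof unfold_locales
    fix i a b assume i: "i < n" and ab: "bar E a b" "p i \<in> closed_segment (p a) (p b)"
    obtain j where j: "bar E i j" using nb(1)[OF i] by blast
    show "i = a \<or> i = b"
    proof (cases "{i, j} = {a, b}")
      case False
      then have "p i \<in> p ` ({i, j} \<inter> {a, b})"
        using non_crossing_bars[OF nc j ab(1)] ab(2) by auto
      then obtain c where "c \<in> {a, b}" "p i = p c" by blast
      then show ?thesis using inj less[OF ab(1)] i by (auto simp: inj_on_def)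
    qed (auto simp: doubleton_eq_iff)
  next
    fix a b c d x assume "bar E a b" "bar E c d" "x \<in> closed_segment (p a) (p b)"
      "x \<in> closed_segment (p c) (p d)" "x \<notin> p ` {..<n}"
    then show "{a, b} = {c, d}" using non_crossing_bars[OF nc, of a b c d] less by blast
  qed (use \<omega> inj E nb col in auto)
  then show False using no by blast
qed

lemma arc_not_stressed: "\<not> stressed_linkage n p \<omega> (arc_edges n)"
proof
  assume "stressed_linkage n p \<omega> (arc_edges n)"
  then interpret stressed_linkage n p \<omega> "arc_edges n" .
  define i where "i = (LEAST i. hull_vertex i)"
  have i: "hull_vertex i" unfolding i_def using hull_vertex_exists LeastI_ex by blast
  have le: "i \<le> j" if "hull_vertex j" for j unfolding i_def using that by (rule Least_le)
  obtain j k where "j \<noteq> k" "bar (arc_edges n) i j" "bar (arc_edges n) i k" "hull_vertex j" "hull_vertex k"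
    using hull_vertex_two_bars[OF i] by metis
  then show False using le[of j] le[of k] by (auto simp: bar_def arc_edges_def)
qed

lemma polygon_bar_cases:
  assumes "i < n" "bar (polygon_edges n) i j"
  shows "j = (i + 1) mod n \<or> j = (i + (n - 1)) mod n"
proof -
  have "j = (i + 1) mod n \<or> (j < n \<and> i = (j + 1) mod n)"
    using assms(2) by (auto simp: bar_def polygon_edges_def)
  moreover have "j = (i + (n - 1)) mod n" if "j < n" "i = (j + 1) mod n"
  proof -
    have "(i + (n - 1)) mod n = (j + 1 + (n - 1)) mod n" unfolding that(2) by (simp add: mod_add_left_eq)
    also have "\<dots> = (j + n) mod n" using assms(1) by simp
    finally show ?thesis using that(1) by simp
  qed
  ultimately show ?thesis by blast
qed

lemma polygon_not_stressed:
  assumes nconv: "\<not> convex_polygon n p"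
  shows "\<not> stressed_linkage n p \<omega> (polygon_edges n)"
proof
  assume "stressed_linkage n p \<omega> (polygon_edges n)"
  then interpret stressed_linkage n p \<omega> "polygon_edges n" .
  have step: "hull_vertex ((i + 1) mod n) \<and> one_sided i ((i + 1) mod n)" if i: "hull_vertex i" for i
  proof -
    have "i < n" using i by (simp add: hull_vertex_def)
    obtain j k where jk: "j \<noteq> k" "bar (polygon_edges n) i j" "bar (polygon_edges n) i k"
      "hull_vertex j" "hull_vertex k" "one_sided i j" "one_sided i k"
      using hull_vertex_two_bars[OF i] by blast
    then show ?thesis
      using polygon_bar_cases[OF \<open>i < n\<close> jk(2)] polygon_bar_cases[OF \<open>i < n\<close> jk(3)] by auto
  qed
  obtain i0 where i0: "hull_vertex i0" using hull_vertex_exists by blast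
  then have i0n: "i0 < n" by (simp add: hull_vertex_def)
  have run: "hull_vertex ((i0 + m) mod n)" for m
  proof (induction m)
    case 0
    then show ?case using i0 i0n by simp
  next
    case (Suc m)
    then show ?case using step[OF Suc] by (simp add: mod_Suc_eq)
  qed
  have "hull_vertex i" if "i < n" for i
  proof -
    have "(i0 + (n - i0 + i)) mod n = i" using i0n that by simp
    then show ?thesis using run by metis
  qed
  then have "one_sided i j" if "(i, j) \<in> polygon_edges n" for i j
    using step that by (auto simp: polygon_edges_def)
  then have "convex_polygon n p"
    unfolding convex_polygon_def one_sided_def by blast
  then show False using nconv by blast
qed

theorem theorem4p3:
  fixes n :: nat and p :: "nat \<Rightarrow> real^2" and E :: "(nat \<times> nat) set"
  assumes "(3 \<le> n \<and> E = polygon_edges n \<and> non_crossing n p E \<and> general_position n p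
              \<and> \<not> convex_polygon n p)
         \<or> (2 \<le> n \<and> E = arc_edges n \<and> non_crossing n p E \<and> \<not> collinear (p ` {..<n}))"
  shows "\<exists>v :: nat \<Rightarrow> real^2. is_flex n p E v \<and> expansive n p v \<and>
           (\<exists>i<n. \<exists>j<n. strictly_expansive_on p v i j)"
  using assms
proof
  assume poly: "3 \<le> n \<and> E = polygon_edges n \<and> non_crossing n p E \<and> general_position n p
              \<and> \<not> convex_polygon n p"
  then have n: "3 \<le> n" and E: "E = polygon_edges n" by auto
  show ?thesis
  proof (rule flex_if_no_stressed_linkage)
    show "E \<subseteq> {..<n} \<times> {..<n}" using n by (auto simp: E polygon_edges_def)
    show "\<exists>j. bar E i j" if "i < n" for i using that by (auto simp: E bar_def polygon_edges_def)
    show "\<exists>k l. \<forall>j. bar E i j \<longrightarrow> j = k \<or> j = l" if "i < n" for i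
      using polygon_bar_cases[OF that] unfolding E by blast
    show "\<not> collinear (p ` {..<n})"
    proof
      assume "collinear (p ` {..<n})"
      moreover have "{p 0, p 1, p 2} \<subseteq> p ` {..<n}" using n by auto
      ultimately have "collinear {p 0, p 1, p 2}" using collinear_subset by blast
      moreover have "\<not> collinear {p i, p j, p k}"
        if "i < n" "j < n" "k < n" "i \<noteq> j" "i \<noteq> k" "j \<noteq> k" for i j k
        using poly that unfolding general_position_def by blast
      from this[of 0 1 2] have "\<not> collinear {p 0, p 1, p 2}" using n by simp
      ultimately show False by blast
    qed
    show "\<not> stressed_linkage n p \<omega> E" for \<omega> using polygon_not_stressed poly by blast
  qed (use poly in blast)
next
  assume arc: "2 \<le> n \<and> E = arc_edges n \<and> non_crossing n p E \<and> \<not> collinear (p ` {..<n})"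
  then have n: "2 \<le> n" and E: "E = arc_edges n" by auto
  show ?thesis
  proof (rule flex_if_no_stressed_linkage)
    show "E \<subseteq> {..<n} \<times> {..<n}" by (auto simp: E arc_edges_def)
    show "\<exists>j. bar E i j" if "i < n" for i
    proof (cases "i + 1 < n")
      case True
      then show ?thesis by (auto simp: E bar_def arc_edges_def)
    next
      case False
      then have "(i - 1, i) \<in> E" using n that by (force simp: E arc_edges_def)
      then show ?thesis by (auto simp: bar_def)
    qed
    show "\<exists>k l. \<forall>j. bar E i j \<longrightarrow> j = k \<or> j = l" for i
      by (rule exI[of _ "i + 1"], rule exI[of _ "i - 1"]) (auto simp: E bar_def arc_edges_def)
    show "\<not> stressed_linkage n p \<omega> E" for \<omega> using arc_not_stressed E by blast
  qed (use arc in blast)+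
qed

end
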